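(* Let $A$ be an abelian group and $B$ a finite subgroup of $\mathrm{Aut}(A)$. Let $G = A \rtimes B$ be the semidirect product of $A$ and $B$ (with $B$ acting on $A$ as a group of automorphisms), and assume that $A$ is a characteristic subgroup of $G$. Then $\omega(G) < \infty$ if and only if $A$ has only finitely many orbits under the action of $C_{\mathrm{Aut}(A)}(B)$.
   Context: For a group $G$, $\omega(G)$ denotes the number of orbits of the natural action of $\mathrm{Aut}(G)$ on $G$. For a group $A$ and a subgroup $B \leqslant \mathrm{Aut}(A)$, $C_{\mathrm{Aut}(A)}(B) = \{c \in \mathrm{Aut}(A) \mid b^c = b \text{ for all } b \in B\}$, where $b^c = c^{-1}bc$; that is, the centralizer of $B$ in $\mathrm{Aut}(A)$. *)

theory Defs
  imports "HOL-Algebra.Group_Action" "HOL-Library.Extended_Nat"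
begin

text \<open>Automorphisms are the extensional functions in \<open>auto G\<close>, and multiplication in
  \<open>AutoGroup G\<close> is \<open>f \<otimes> g = f \<circ> g\<close>, so they act from the left. The action
  on \<open>carrier G\<close> is the identity map \<open>\<lambda>f. f\<close>.\<close>

definition omega :: "('a, 'm) monoid_scheme \<Rightarrow> enat" where
  "omega G =
     (let \<O> = orbits (AutoGroup G) (carrier G) (\<lambda>f. f)
      in if finite \<O> then enat (card \<O>) else \<infinity>)"

definition centralizer :: "('a, 'm) monoid_scheme \<Rightarrow> 'a set \<Rightarrow> 'a set" where
  "centralizer G S =
     {c \<in> carrier G. \<forall>b \<in> S. inv\<^bsub>G\<^esub> c \<otimes>\<^bsub>G\<^esub> b \<otimes>\<^bsub>G\<^esub> c = b}"

definition characteristic_subgroup :: "'a set \<Rightarrow> ('a, 'm) monoid_scheme \<Rightarrow> bool" where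
  "characteristic_subgroup H G \<longleftrightarrow> subgroup H G \<and> (\<forall>f \<in> auto G. f ` H = H)"

definition semidirect ::
  "('a, 'm) monoid_scheme \<Rightarrow> ('b, 'n) monoid_scheme \<Rightarrow> ('b \<Rightarrow> 'a \<Rightarrow> 'a) \<Rightarrow> ('a \<times> 'b) monoid" where
  "semidirect N H \<theta> =
     \<lparr>carrier = carrier N \<times> carrier H,
      monoid.mult = (\<lambda>(a, h) (a', h'). (a \<otimes>\<^bsub>N\<^esub> \<theta> h a', h \<otimes>\<^bsub>H\<^esub> h')),
      one = (\<one>\<^bsub>N\<^esub>, \<one>\<^bsub>H\<^esub>)\<rparr>"

lemma group_semidirect:
  assumes N: "group N" and H: "group H" and \<theta>: "\<theta> \<in> hom H (AutoGroup N)"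
  shows "group (semidirect N H \<theta>)"
proof -
  interpret N: group N by (rule N)
  interpret H: group H by (rule H)
  have aut: "\<theta> h \<in> auto N" if "h \<in> carrier H" for h
    using \<theta> that by (auto simp: hom_def AutoGroup_def)
  have bij: "\<theta> h \<in> Bij (carrier N)" if "h \<in> carrier H" for h
    using aut[OF that] by (simp add: auto_def)
  have cl: "\<theta> h a \<in> carrier N" if "h \<in> carrier H" "a \<in> carrier N" for h a
    using aut[OF that(1)] that(2) by (auto simp: auto_def hom_def)
  have mlt: "\<theta> h (a \<otimes>\<^bsub>N\<^esub> b) = \<theta> h a \<otimes>\<^bsub>N\<^esub> \<theta> h b"
    if "h \<in> carrier H" "a \<in> carrier N" "b \<in> carrier N" for h a b
    using aut[OF that(1)] that(2,3) by (auto simp: auto_def hom_def)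
  have cmp: "\<theta> (g \<otimes>\<^bsub>H\<^esub> h) a = \<theta> g (\<theta> h a)"
    if "g \<in> carrier H" "h \<in> carrier H" "a \<in> carrier N" for g h a
    using hom_mult[OF \<theta> that(1,2)] bij[OF that(1)] bij[OF that(2)] that(3)
    by (simp add: AutoGroup_def BijGroup_def compose_def)
  have id: "\<theta> \<one>\<^bsub>H\<^esub> a = a" if "a \<in> carrier N" for a
    using hom_one[OF \<theta> H N.AutoGroup] that
    by (simp add: AutoGroup_def BijGroup_def)
  show ?thesis
  proof (rule groupI)
    fix x y assume "x \<in> carrier (semidirect N H \<theta>)" "y \<in> carrier (semidirect N H \<theta>)"
    then show "x \<otimes>\<^bsub>semidirect N H \<theta>\<^esub> y \<in> carrier (semidirect N H \<theta>)"
      by (auto simp: semidirect_def cl)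
  next
    show "\<one>\<^bsub>semidirect N H \<theta>\<^esub> \<in> carrier (semidirect N H \<theta>)"
      by (simp add: semidirect_def)
  next
    fix x y z
    assume "x \<in> carrier (semidirect N H \<theta>)" "y \<in> carrier (semidirect N H \<theta>)"
      "z \<in> carrier (semidirect N H \<theta>)"
    then show "x \<otimes>\<^bsub>semidirect N H \<theta>\<^esub> y \<otimes>\<^bsub>semidirect N H \<theta>\<^esub> z =
        x \<otimes>\<^bsub>semidirect N H \<theta>\<^esub> (y \<otimes>\<^bsub>semidirect N H \<theta>\<^esub> z)"
      by (auto simp: semidirect_def cl mlt cmp N.m_assoc H.m_assoc)
  next
    fix x assume "x \<in> carrier (semidirect N H \<theta>)"
    then show "\<one>\<^bsub>semidirect N H \<theta>\<^esub> \<otimes>\<^bsub>semidirect N H \<theta>\<^esub> x = x"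
      by (auto simp: semidirect_def id)
  next
    fix x assume "x \<in> carrier (semidirect N H \<theta>)"
    then obtain a h where x: "x = (a, h)" "a \<in> carrier N" "h \<in> carrier H"
      by (auto simp: semidirect_def)
    have "\<theta> (inv\<^bsub>H\<^esub> h) (inv\<^bsub>N\<^esub> a) \<otimes>\<^bsub>N\<^esub> \<theta> (inv\<^bsub>H\<^esub> h) a = \<one>\<^bsub>N\<^esub>"
      using x mlt[of "inv\<^bsub>H\<^esub> h" "inv\<^bsub>N\<^esub> a" a] mlt[of "inv\<^bsub>H\<^esub> h" "\<one>\<^bsub>N\<^esub>" "\<one>\<^bsub>N\<^esub>"]
        cl[of "inv\<^bsub>H\<^esub> h" "\<one>\<^bsub>N\<^esub>"] by simp
    then show "\<exists>y \<in> carrier (semidirect N H \<theta>).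
        y \<otimes>\<^bsub>semidirect N H \<theta>\<^esub> x = \<one>\<^bsub>semidirect N H \<theta>\<^esub>"
      using x
      by (intro bexI[of _ "(\<theta> (inv\<^bsub>H\<^esub> h) (inv\<^bsub>N\<^esub> a), inv\<^bsub>H\<^esub> h)"])
        (auto simp: semidirect_def cl)
  qed
qed

lemma inclusion_hom_AutoGroup:
  assumes "group A" and "subgroup B (AutoGroup A)"
  shows "(\<lambda>b. b) \<in> hom ((AutoGroup A)\<lparr>carrier := B\<rparr>) (AutoGroup A)"
  using subgroup.subset[OF assms(2)] by (auto simp: hom_def)

lemma subgroup_centralizer:
  assumes "group G" and "S \<subseteq> carrier G"
  shows "subgroup (centralizer G S) G"
proof -
  interpret group G by (rule assms)
  have eq: "centralizer G S =
      {c \<in> carrier G. \<forall>b \<in> S. b \<otimes>\<^bsub>G\<^esub> c = c \<otimes>\<^bsub>G\<^esub> b}"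
    using assms(2) unfolding centralizer_def
    by (auto simp: m_assoc subset_iff inv_solve_left')
  show ?thesis
  proof (rule subgroupI)
    show "centralizer G S \<subseteq> carrier G" by (auto simp: eq)
    have "\<one>\<^bsub>G\<^esub> \<in> centralizer G S"
      using assms(2) by (auto simp: eq subset_iff)
    then show "centralizer G S \<noteq> {}" by blast
  next
    fix c assume c: "c \<in> centralizer G S"
    have "b \<otimes>\<^bsub>G\<^esub> inv\<^bsub>G\<^esub> c = inv\<^bsub>G\<^esub> c \<otimes>\<^bsub>G\<^esub> b" if "b \<in> S" for b
    proof -
      have b: "b \<in> carrier G" "c \<in> carrier G" using that assms(2) c by (auto simp: eq)
      have "inv\<^bsub>G\<^esub> c \<otimes>\<^bsub>G\<^esub> b \<otimes>\<^bsub>G\<^esub> c = b" using c that by (simp add: centralizer_def)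
      then have "b \<otimes>\<^bsub>G\<^esub> inv\<^bsub>G\<^esub> c = inv\<^bsub>G\<^esub> c \<otimes>\<^bsub>G\<^esub> b \<otimes>\<^bsub>G\<^esub> c \<otimes>\<^bsub>G\<^esub> inv\<^bsub>G\<^esub> c" by simp
      then show ?thesis using b by (simp add: m_assoc)
    qed
    then show "inv\<^bsub>G\<^esub> c \<in> centralizer G S" using c by (auto simp: eq)
  next
    fix c d assume c: "c \<in> centralizer G S" and d: "d \<in> centralizer G S"
    have "b \<otimes>\<^bsub>G\<^esub> (c \<otimes>\<^bsub>G\<^esub> d) = c \<otimes>\<^bsub>G\<^esub> d \<otimes>\<^bsub>G\<^esub> b" if "b \<in> S" for b
    proof -
      have cl: "b \<in> carrier G" "c \<in> carrier G" "d \<in> carrier G"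
        using that assms(2) c d by (auto simp: eq)
      have "b \<otimes>\<^bsub>G\<^esub> c = c \<otimes>\<^bsub>G\<^esub> b" "b \<otimes>\<^bsub>G\<^esub> d = d \<otimes>\<^bsub>G\<^esub> b"
        using c d that by (auto simp: eq)
      then show ?thesis using cl by (metis m_assoc)
    qed
    then show "c \<otimes>\<^bsub>G\<^esub> d \<in> centralizer G S" using c d by (auto simp: eq)
  qed
qed

end

(* An automorphism of G preserving A permutes the cosets of A, and there are only finitely many
   such permutations because B is finite. As A is abelian, an automorphism fixing every coset of A
   restricts on A to a map commuting with B: compare the images of b a = (b.a) b. So two
   automorphisms of G inducing the same permutation differ on A by an element of the centralizer C
   of B, and an orbit of Aut(G) meets A in finitely many orbits of C. Conversely, each c in C
   extends to the automorphism (a, b) |-> (c a, b) of G, so G is a union of |B| copies of A, each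
   having finitely many orbits. *)

theory Submission
  imports Defs
begin

section \<open>Finite sets meeting every orbit\<close>

text \<open>One chosen point per orbit gives \<open>F\<close>; conversely, orbits that meet
  coincide, so each orbit is that of some point of \<open>F\<close>. As \<open>F\<close> may meet an
  orbit several times, finiteness can be proved by exhibiting any finite covering set, with no
  counting.\<close>

lemma (in group_action) finite_orbits_iff:
  "finite (orbits G E \<phi>) \<longleftrightarrow>
    (\<exists>F. finite F \<and> F \<subseteq> E \<and> (\<forall>x\<in>E. \<exists>y\<in>F. \<exists>g\<in>carrier G. x = \<phi> g y))"
proof
  assume fin: "finite (orbits G E \<phi>)"
  define r where "r = (\<lambda>Q. SOME y. y \<in> E \<and> Q = orbit G \<phi> y)"
  have r: "r Q \<in> E \<and> Q = orbit G \<phi> (r Q)" if "Q \<in> orbits G E \<phi>" for Q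
    unfolding r_def by (rule someI_ex) (use that in \<open>auto simp: orbits_def\<close>)
  have "\<exists>y\<in>r ` orbits G E \<phi>. \<exists>g\<in>carrier G. x = \<phi> g y" if "x \<in> E" for x
  proof -
    have Q: "orbit G \<phi> x \<in> orbits G E \<phi>" using that by (auto simp: orbits_def)
    have "x \<in> orbit G \<phi> (r (orbit G \<phi> x))"
      using orbit_refl[OF that] r[OF Q] by simp
    then show ?thesis using Q by (auto simp: orbit_def)
  qed
  then show "\<exists>F. finite F \<and> F \<subseteq> E \<and> (\<forall>x\<in>E. \<exists>y\<in>F. \<exists>g\<in>carrier G. x = \<phi> g y)"
    using fin r by (intro exI[of _ "r ` orbits G E \<phi>"]) blast
next
  assume "\<exists>F. finite F \<and> F \<subseteq> E \<and> (\<forall>x\<in>E. \<exists>y\<in>F. \<exists>g\<in>carrier G. x = \<phi> g y)"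
  then obtain F where F: "finite F" "F \<subseteq> E"
    and cover: "\<And>x. x \<in> E \<Longrightarrow> \<exists>y\<in>F. \<exists>g\<in>carrier G. x = \<phi> g y" by blast
  have "orbit G \<phi> x \<in> orbit G \<phi> ` F" if x: "x \<in> E" for x
  proof -
    obtain y g where y: "y \<in> F" "g \<in> carrier G" "x = \<phi> g y" using cover[OF x] by blast
    then have "x \<in> orbit G \<phi> x \<inter> orbit G \<phi> y"
      using orbit_refl[OF x] by (auto simp: orbit_def)
    then have "orbit G \<phi> x = orbit G \<phi> y"
      using disjoint_union[of "orbit G \<phi> x" "orbit G \<phi> y"] x y F by (auto simp: orbits_def)
    then show ?thesis using y by blast
  qed
  then have "orbits G E \<phi> \<subseteq> orbit G \<phi> ` F" by (auto simp: orbits_def)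
  then show "finite (orbits G E \<phi>)" using F(1) finite_surj by blast
qed

section \<open>Automorphism groups and centralizers in them\<close>

lemma carrier_AutoGroup: "carrier (AutoGroup G) = auto G"
  by (simp add: AutoGroup_def)

lemma mult_AutoGroup_apply:
  assumes "f \<in> auto G" "g \<in> auto G" "x \<in> carrier G"
  shows "(f \<otimes>\<^bsub>AutoGroup G\<^esub> g) x = f (g x)"
  using assms by (simp add: AutoGroup_def BijGroup_def auto_def compose_eq)

lemma group_action_AutoGroup:
  assumes "group G"
  shows "group_action (AutoGroup G) (carrier G) (\<lambda>f. f)"
proof -
  have "(\<lambda>f. f) \<in> hom (AutoGroup G) (BijGroup (carrier G))"
    by (auto simp: hom_def AutoGroup_def BijGroup_def auto_def)
  then show ?thesis
    using group.AutoGroup[OF assms] group_BijGroup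
    by (simp add: group_action_def group_hom_def group_hom_axioms_def)
qed

text \<open>Multiplying by \<open>c\<close> on the left turns the conjugation equation into
  commutation of \<open>b\<close> and \<open>c\<close>. Products in \<open>AutoGroup G\<close> are
  compositions restricted to the carrier, so this is a pointwise condition there.\<close>

lemma mem_centralizer_AutoGroup_iff:
  assumes "group G" and S: "S \<subseteq> auto G"
  shows "c \<in> centralizer (AutoGroup G) S \<longleftrightarrow>
    c \<in> auto G \<and> (\<forall>b\<in>S. \<forall>x\<in>carrier G. b (c x) = c (b x))"
proof -
  interpret Aut: group "AutoGroup G" by (rule group.AutoGroup[OF assms(1)])
  have "inv\<^bsub>AutoGroup G\<^esub> c \<otimes>\<^bsub>AutoGroup G\<^esub> b \<otimes>\<^bsub>AutoGroup G\<^esub> c = b \<longleftrightarrow>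
      (\<forall>x\<in>carrier G. b (c x) = c (b x))" if c: "c \<in> auto G" and b: "b \<in> auto G" for b
  proof -
    have "inv\<^bsub>AutoGroup G\<^esub> c \<otimes>\<^bsub>AutoGroup G\<^esub> b \<otimes>\<^bsub>AutoGroup G\<^esub> c = b \<longleftrightarrow>
        b \<otimes>\<^bsub>AutoGroup G\<^esub> c = c \<otimes>\<^bsub>AutoGroup G\<^esub> b"
      using Aut.inv_solve_left'[of b c "b \<otimes>\<^bsub>AutoGroup G\<^esub> c"] c b Aut.m_closed[of b c] Aut.inv_closed[of c]
      by (simp add: carrier_AutoGroup Aut.m_assoc)
    also have "\<dots> \<longleftrightarrow> compose (carrier G) b c = compose (carrier G) c b"
      using c b by (simp add: AutoGroup_def BijGroup_def auto_def)
    also have "\<dots> \<longleftrightarrow> (\<forall>x\<in>carrier G. b (c x) = c (b x))"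
      by (auto simp: compose_def restrict_def fun_eq_iff)
    finally show ?thesis .
  qed
  then show ?thesis
    using S by (auto simp: centralizer_def carrier_AutoGroup)
qed

section \<open>Automorphisms of a semidirect product\<close>

text \<open>The argument sees the acting group only through \<open>\<theta>\<close>, so it is stated
  for an abstract \<open>H\<close>; the case of automorphisms acting on \<open>A\<close> takes
  \<open>H\<close> to be \<open>B\<close> and \<open>\<theta>\<close> the inclusion.\<close>

locale semidirect_product = N: group N + H: group H
  for N :: "('a, 'm) monoid_scheme" (structure) and H :: "('b, 'n) monoid_scheme" (structure)
    and \<theta> :: "'b \<Rightarrow> 'a \<Rightarrow> 'a" +
  assumes hom: "\<theta> \<in> hom H (AutoGroup N)"
begin

abbreviation "G \<equiv> semidirect N H \<theta>"
abbreviation "C \<equiv> centralizer (AutoGroup N) (\<theta> ` carrier H)"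

sublocale G: group G
  by (intro group_semidirect hom N.group_axioms H.group_axioms)

lemma carrier_G: "carrier G = carrier N \<times> carrier H"
  by (simp add: semidirect_def)

lemma mult_G: "(a, h) \<otimes>\<^bsub>G\<^esub> (a', h') = (a \<otimes>\<^bsub>N\<^esub> \<theta> h a', h \<otimes>\<^bsub>H\<^esub> h')"
  by (simp add: semidirect_def)

lemma theta_auto: "\<theta> ` carrier H \<subseteq> auto N"
  using hom by (auto simp: hom_def carrier_AutoGroup)

lemma theta_closed: "h \<in> carrier H \<Longrightarrow> a \<in> carrier N \<Longrightarrow> \<theta> h a \<in> carrier N"
  using theta_auto by (auto simp: auto_def hom_def)

lemma theta_one: "a \<in> carrier N \<Longrightarrow> \<theta> \<one>\<^bsub>H\<^esub> a = a"
  using hom_one[OF hom H.group_axioms N.AutoGroup] by (simp add: AutoGroup_def BijGroup_def)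

lemma mem_C_iff:
  "c \<in> C \<longleftrightarrow> c \<in> auto N \<and> (\<forall>h\<in>carrier H. \<forall>a\<in>carrier N. \<theta> h (c a) = c (\<theta> h a))"
  using mem_centralizer_AutoGroup_iff[OF N.group_axioms theta_auto] by simp

text \<open>Commuting with \<open>\<theta> h\<close> is what makes the extension multiplicative:
  \<open>c\<close> maps the first coordinate a (\<open>\<theta> h\<close> a') of a product to (c a)
  (\<open>\<theta> h\<close> (c a')). The restriction to the carrier is there because members of
  \<open>auto\<close> are extensional.\<close>

lemma extend_centralizer_auto:
  assumes "c \<in> C"
  shows "(\<lambda>(a, h)\<in>carrier G. (c a, h)) \<in> auto G"
proof -
  have c: "c \<in> hom N N" "bij_betw c (carrier N) (carrier N)"
    and comm: "\<And>h a. h \<in> carrier H \<Longrightarrow> a \<in> carrier N \<Longrightarrow> \<theta> h (c a) = c (\<theta> h a)"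
    using assms by (auto simp: mem_C_iff auto_def Bij_def)
  have "bij_betw (\<lambda>(a, h). (c a, h)) (carrier G) (carrier G)"
    using bij_betw_map_prod[OF c(2) bij_betw_id[of "carrier H"]]
    by (simp add: map_prod_def carrier_G)
  then have "bij_betw (\<lambda>(a, h)\<in>carrier G. (c a, h)) (carrier G) (carrier G)"
    by (subst (asm) bij_betw_restrict_eq[symmetric])
  then show ?thesis
    using c(1) by (auto simp: auto_def Bij_def hom_def carrier_G mult_G theta_closed comm Pi_iff)
qed

text \<open>Applying \<open>\<gamma>\<close> to the relation h a = (h.a) h in \<open>G\<close> shows
  that the restriction of \<open>\<gamma>\<close> to \<open>N\<close> commutes with the action of h,
  up to the first coordinate of the image of h, which cancels because \<open>N\<close> is
  abelian.\<close>

lemma restrict_fixing_cosets_centralizer: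
  assumes "comm_group N" and \<gamma>: "\<gamma> \<in> auto G"
    and inv: "\<gamma> ` (carrier N \<times> {\<one>\<^bsub>H\<^esub>}) = carrier N \<times> {\<one>\<^bsub>H\<^esub>}"
    and coset: "\<And>z. z \<in> carrier G \<Longrightarrow> snd (\<gamma> z) = snd z"
  shows "(\<lambda>a\<in>carrier N. fst (\<gamma> (a, \<one>\<^bsub>H\<^esub>))) \<in> C"
proof -
  interpret N: comm_group N by (rule assms(1))
  define c where "c = (\<lambda>a\<in>carrier N. fst (\<gamma> (a, \<one>\<^bsub>H\<^esub>)))"
  have \<gamma>c: "\<gamma> (a, \<one>\<^bsub>H\<^esub>) = (c a, \<one>\<^bsub>H\<^esub>)" and cl: "c a \<in> carrier N" if "a \<in> carrier N" for a
    using that inv by (auto simp: c_def image_subset_iff mem_Times_iff prod_eq_iff dest!: equalityD1)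
  have \<gamma>mult: "\<gamma> (x \<otimes>\<^bsub>G\<^esub> y) = \<gamma> x \<otimes>\<^bsub>G\<^esub> \<gamma> y" if "x \<in> carrier G" "y \<in> carrier G" for x y
    using \<gamma> that by (auto simp: auto_def hom_def)
  have inj: "inj_on \<gamma> (carrier G)" and img: "\<gamma> ` carrier G = carrier G"
    using \<gamma> by (auto simp: auto_def Bij_def bij_betw_def)
  have "c (a \<otimes>\<^bsub>N\<^esub> b) = c a \<otimes>\<^bsub>N\<^esub> c b" if "a \<in> carrier N" "b \<in> carrier N" for a b
    using \<gamma>mult[of "(a, \<one>\<^bsub>H\<^esub>)" "(b, \<one>\<^bsub>H\<^esub>)"] that
    by (simp add: carrier_G mult_G theta_one \<gamma>c cl)
  moreover have "inj_on c (carrier N)"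
  proof (rule inj_onI)
    fix a b assume "a \<in> carrier N" "b \<in> carrier N" "c a = c b"
    then show "a = b"
      using inj_onD[OF inj, of "(a, \<one>\<^bsub>H\<^esub>)" "(b, \<one>\<^bsub>H\<^esub>)"] by (simp add: \<gamma>c carrier_G)
  qed
  moreover have "x \<in> c ` carrier N" if "x \<in> carrier N" for x
  proof -
    have "(x, \<one>\<^bsub>H\<^esub>) \<in> \<gamma> ` (carrier N \<times> {\<one>\<^bsub>H\<^esub>})" using that inv by simp
    then show ?thesis by (auto simp: \<gamma>c)
  qed
  then have "c ` carrier N = carrier N" using cl by blast
  moreover have "c \<in> extensional (carrier N)" by (simp add: c_def)
  ultimately have "c \<in> auto N"
    by (auto simp: auto_def hom_def Bij_def bij_betw_def)
  moreover have "\<theta> h (c a) = c (\<theta> h a)" if h: "h \<in> carrier H" and a: "a \<in> carrier N" for h a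
  proof -
    \<comment> \<open>Since \<open>\<gamma>\<close> fixes the coset of h, it can move (1, h) only by
      an unknown first coordinate x.\<close>
    have "\<gamma> (\<one>\<^bsub>N\<^esub>, h) \<in> carrier G" using img h by (auto simp: carrier_G)
    moreover have "snd (\<gamma> (\<one>\<^bsub>N\<^esub>, h)) = h" using coset[of "(\<one>\<^bsub>N\<^esub>, h)"] h by (simp add: carrier_G)
    ultimately obtain x where x: "\<gamma> (\<one>\<^bsub>N\<^esub>, h) = (x, h)" "x \<in> carrier N"
      by (cases "\<gamma> (\<one>\<^bsub>N\<^esub>, h)") (auto simp: carrier_G)
    have "(\<one>\<^bsub>N\<^esub>, h) \<otimes>\<^bsub>G\<^esub> (a, \<one>\<^bsub>H\<^esub>) = (\<theta> h a, \<one>\<^bsub>H\<^esub>) \<otimes>\<^bsub>G\<^esub> (\<one>\<^bsub>N\<^esub>, h)"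
      using h a by (simp add: mult_G theta_closed theta_one)
    then have "(x, h) \<otimes>\<^bsub>G\<^esub> (c a, \<one>\<^bsub>H\<^esub>) = (c (\<theta> h a), \<one>\<^bsub>H\<^esub>) \<otimes>\<^bsub>G\<^esub> (x, h)"
      using h a x \<gamma>mult[of "(\<one>\<^bsub>N\<^esub>, h)" "(a, \<one>\<^bsub>H\<^esub>)"] \<gamma>mult[of "(\<theta> h a, \<one>\<^bsub>H\<^esub>)" "(\<one>\<^bsub>N\<^esub>, h)"]
      by (simp add: carrier_G theta_closed \<gamma>c)
    \<comment> \<open>Comparing first coordinates leaves x on the left of one side and on the right
      of the other; commutativity brings both to the left for cancellation.\<close>
    then have "x \<otimes>\<^bsub>N\<^esub> \<theta> h (c a) = x \<otimes>\<^bsub>N\<^esub> c (\<theta> h a)"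
      using h a x by (simp add: mult_G theta_one cl theta_closed N.m_comm)
    then show ?thesis using h a x by (simp add: cl theta_closed)
  qed
  ultimately show ?thesis by (simp add: mem_C_iff flip: c_def)
qed

text \<open>In (a, h) = (a, 1)(1, h) the first factor stays in the copy of \<open>N\<close> under
  \<open>\<alpha>\<close> and adds nothing to the second coordinate. So \<open>\<alpha>\<close>
  induces a well-defined map on the cosets of \<open>N\<close>, readable at the representatives (1,
  h).\<close>

lemma snd_auto_eq:
  assumes \<alpha>: "\<alpha> \<in> auto G" and inv: "\<alpha> ` (carrier N \<times> {\<one>\<^bsub>H\<^esub>}) = carrier N \<times> {\<one>\<^bsub>H\<^esub>}"
    and a: "a \<in> carrier N" and h: "h \<in> carrier H"
  shows "snd (\<alpha> (a, h)) = snd (\<alpha> (\<one>\<^bsub>N\<^esub>, h))"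
proof -
  have mult: "\<alpha> (x \<otimes>\<^bsub>G\<^esub> y) = \<alpha> x \<otimes>\<^bsub>G\<^esub> \<alpha> y" if "x \<in> carrier G" "y \<in> carrier G" for x y
    using \<alpha> that by (auto simp: auto_def hom_def)
  have "\<alpha> (a, \<one>\<^bsub>H\<^esub>) \<in> carrier N \<times> {\<one>\<^bsub>H\<^esub>}" using inv a by blast
  then obtain a' where a': "\<alpha> (a, \<one>\<^bsub>H\<^esub>) = (a', \<one>\<^bsub>H\<^esub>)" by (elim SigmaE singletonE) simp
  have "\<alpha> (\<one>\<^bsub>N\<^esub>, h) \<in> carrier N \<times> carrier H"
    using \<alpha> h by (auto simp: auto_def hom_def carrier_G)
  then obtain x k where x: "\<alpha> (\<one>\<^bsub>N\<^esub>, h) = (x, k)" "k \<in> carrier H" by (rule SigmaE)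
  have "\<alpha> (a, h) = \<alpha> ((a, \<one>\<^bsub>H\<^esub>) \<otimes>\<^bsub>G\<^esub> (\<one>\<^bsub>N\<^esub>, h))"
    using a h by (simp add: mult_G theta_one)
  also have "\<dots> = (a', \<one>\<^bsub>H\<^esub>) \<otimes>\<^bsub>G\<^esub> (x, k)"
    using a h x a' mult[of "(a, \<one>\<^bsub>H\<^esub>)" "(\<one>\<^bsub>N\<^esub>, h)"] by (simp add: carrier_G)
  finally show ?thesis using x by (simp add: mult_G)
qed

section \<open>Transfer of finiteness between the two actions\<close>

theorem finite_omega_iff_finite_centralizer_orbits:
  assumes comm: "comm_group N" and fin: "finite (carrier H)"
    and char: "characteristic_subgroup (carrier N \<times> {\<one>\<^bsub>H\<^esub>}) G"
  shows "omega G < \<infinity> \<longleftrightarrow>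
    finite (orbits ((AutoGroup N)\<lparr>carrier := C\<rparr>) (carrier N) (\<lambda>c. c))"
proof -
  interpret Aut: group "AutoGroup G" by (rule G.AutoGroup)
  interpret onG: group_action "AutoGroup G" "carrier G" "\<lambda>f. f"
    by (rule group_action_AutoGroup[OF G.group_axioms])
  have "subgroup C (AutoGroup N)"
    using theta_auto by (intro subgroup_centralizer N.AutoGroup) (simp add: carrier_AutoGroup)
  then interpret onN: group_action "(AutoGroup N)\<lparr>carrier := C\<rparr>" "carrier N" "\<lambda>c. c"
    by (rule group_action.induced_action[OF group_action_AutoGroup[OF N.group_axioms]])
  have inv: "\<alpha> ` (carrier N \<times> {\<one>\<^bsub>H\<^esub>}) = carrier N \<times> {\<one>\<^bsub>H\<^esub>}" if "\<alpha> \<in> auto G" for \<alpha>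
    using char that by (simp add: characteristic_subgroup_def)
  have "finite (orbits (AutoGroup G) (carrier G) (\<lambda>f. f)) \<longleftrightarrow>
    finite (orbits ((AutoGroup N)\<lparr>carrier := C\<rparr>) (carrier N) (\<lambda>c. c))"
  proof
    assume "finite (orbits ((AutoGroup N)\<lparr>carrier := C\<rparr>) (carrier N) (\<lambda>c. c))"
    then obtain F where F: "finite F" "F \<subseteq> carrier N"
      and cover: "\<And>x. x \<in> carrier N \<Longrightarrow> \<exists>y\<in>F. \<exists>c\<in>C. x = c y"
      unfolding onN.finite_orbits_iff by auto
    \<comment> \<open>The extension of c fixes second coordinates, so one copy of \<open>F\<close>
      in each coset meets every orbit.\<close>
    have "\<exists>z\<in>F \<times> carrier H. \<exists>f\<in>auto G. (a, h) = f z"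
      if a: "a \<in> carrier N" and h: "h \<in> carrier H" for a h
    proof -
      obtain y c where y: "y \<in> F" "c \<in> C" "a = c y" using cover[OF a] by (elim bexE)
      then have "(a, h) = (\<lambda>(a, h)\<in>carrier G. (c a, h)) (y, h)"
        using h F(2) by (auto simp: carrier_G)
      then show ?thesis
        using y h extend_centralizer_auto[OF y(2)]
        by (intro bexI[of _ "(y, h)"] bexI[of _ "\<lambda>(a, h)\<in>carrier G. (c a, h)"]) auto
    qed
    then show "finite (orbits (AutoGroup G) (carrier G) (\<lambda>f. f))"
      unfolding onG.finite_orbits_iff using F fin
      by (intro exI[of _ "F \<times> carrier H"]) (auto simp: carrier_AutoGroup carrier_G)
  next
    assume "finite (orbits (AutoGroup G) (carrier G) (\<lambda>f. f))"
    then obtain F where F: "finite F" "F \<subseteq> carrier G"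
      and cover: "\<And>x. x \<in> carrier G \<Longrightarrow> \<exists>y\<in>F. \<exists>f\<in>auto G. x = f y"
      unfolding onG.finite_orbits_iff carrier_AutoGroup by blast
    \<comment> \<open>The cosets of \<open>N\<close> are indexed by \<open>H\<close>, and
      \<open>\<sigma> \<alpha>\<close> is the map that \<open>\<alpha>\<close> induces on them. It
      is made extensional so that it lies in the finite function space \<open>P\<close>; for the
      count it is enough that there are finitely many such maps.\<close>
    define \<sigma> where "\<sigma> = (\<lambda>\<alpha> :: 'a \<times> 'b \<Rightarrow> 'a \<times> 'b. \<lambda>h\<in>carrier H. snd (\<alpha> (\<one>\<^bsub>N\<^esub>, h)))"
    define P where "P = carrier H \<rightarrow>\<^sub>E carrier H"
    have finP: "finite P" unfolding P_def using fin by (intro finite_PiE) auto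
    have \<sigma>P: "\<sigma> \<alpha> \<in> P" if "\<alpha> \<in> auto G" for \<alpha>
    proof -
      have "\<alpha> (\<one>\<^bsub>N\<^esub>, h) \<in> carrier G" if "h \<in> carrier H" for h
        using \<open>\<alpha> \<in> auto G\<close> that by (auto simp: auto_def hom_def carrier_G)
      then show ?thesis by (auto simp: P_def \<sigma>_def carrier_G mem_Times_iff)
    qed
    have snd_\<sigma>: "snd (\<alpha> z) = \<sigma> \<alpha> (snd z)" if "\<alpha> \<in> auto G" "z \<in> carrier G" for \<alpha> z
      using snd_auto_eq[OF that(1) inv[OF that(1)], of "fst z" "snd z"] that(2)
      by (simp add: \<sigma>_def carrier_G mem_Times_iff)
    \<comment> \<open>The points x of \<open>N\<close> are sorted by a representative y in
      \<open>F\<close> from which (x, 1) is reached and by the coset map p of the automorphism used.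
      One x is chosen for each pair (y, p) that occurs; pairs without any such x are left out of
      \<open>R\<close>, since there the choice would be arbitrary.\<close>
    define good where "good = (\<lambda>y p x. x \<in> carrier N \<and>
      (\<exists>\<alpha>\<in>auto G. \<sigma> \<alpha> = p \<and> (x, \<one>\<^bsub>H\<^esub>) = \<alpha> y))"
    define r where "r = (\<lambda>(y, p). SOME x. good y p x)"
    define R where "R = r ` {(y, p) \<in> F \<times> P. \<exists>x. good y p x}"
    have r: "good y p (r (y, p))" if "good y p x" for y p x
      unfolding r_def using someI[of "good y p", OF that] by simp
    have "finite {(y, p) \<in> F \<times> P. \<exists>x. good y p x}"
      by (rule finite_subset[of _ "F \<times> P"]) (use F finP in auto)
    then have "finite R" by (simp add: R_def)
    moreover have "R \<subseteq> carrier N"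
    proof -
      have "x \<in> carrier N" if "good y p x" for y p x using that by (simp add: good_def)
      then show ?thesis using r unfolding R_def by blast
    qed
    moreover have "\<exists>w\<in>R. \<exists>c\<in>C. x = c w" if x: "x \<in> carrier N" for x
    proof -
      \<comment> \<open>Both x and the chosen point w of its class come from the same y, by
        automorphisms \<open>\<alpha>\<close> and \<open>\<beta>\<close> with equal coset
        maps.\<close>
      obtain y \<alpha> where y: "y \<in> F" "\<alpha> \<in> auto G" "(x, \<one>\<^bsub>H\<^esub>) = \<alpha> y"
        using cover[of "(x, \<one>\<^bsub>H\<^esub>)"] x by (elim meta_impE bexE) (simp_all add: carrier_G)
      then have good: "good y (\<sigma> \<alpha>) x" using x unfolding good_def by blast
      define w where "w = r (y, \<sigma> \<alpha>)"
      have w: "w \<in> R" unfolding R_def w_def using y \<sigma>P good by blast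
      obtain \<beta> where \<beta>: "\<beta> \<in> auto G" "\<sigma> \<beta> = \<sigma> \<alpha>" "(w, \<one>\<^bsub>H\<^esub>) = \<beta> y" and wN: "w \<in> carrier N"
        using r[OF good] unfolding w_def good_def by (elim conjE bexE) simp
      \<comment> \<open>This quotient carries (w, 1) through y to (x, 1), and the two equal coset
        maps cancel in it.\<close>
      define \<gamma> where "\<gamma> = \<alpha> \<otimes>\<^bsub>AutoGroup G\<^esub> inv\<^bsub>AutoGroup G\<^esub> \<beta>"
      have \<gamma>: "\<gamma> \<in> auto G"
        using y(2) \<beta>(1) Aut.m_closed Aut.inv_closed by (simp add: \<gamma>_def carrier_AutoGroup)
      have "\<gamma> \<otimes>\<^bsub>AutoGroup G\<^esub> \<beta> = \<alpha>"
        using y(2) \<beta>(1) by (simp add: \<gamma>_def Aut.m_assoc flip: carrier_AutoGroup)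
      then have \<gamma>\<beta>: "\<gamma> (\<beta> z) = \<alpha> z" if "z \<in> carrier G" for z
        using mult_AutoGroup_apply[OF \<gamma> \<beta>(1) that] by simp
      have "snd (\<gamma> z) = snd z" if "z \<in> carrier G" for z
      proof -
        \<comment> \<open>Writing z as \<open>\<beta> z'\<close> replaces \<open>\<gamma> z\<close>
          by \<open>\<alpha> z'\<close>, which lies in the same coset as \<open>\<beta> z'\<close>
          because \<open>\<sigma> \<alpha> = \<sigma> \<beta>\<close>.\<close>
        have "z \<in> \<beta> ` carrier G"
          using onG.surj_prop[of \<beta>] \<beta>(1) that by (simp add: carrier_AutoGroup)
        then obtain z' where z': "z' \<in> carrier G" "z = \<beta> z'" by blast
        then show ?thesis using \<gamma>\<beta> snd_\<sigma> y(2) \<beta>(1,2) by simp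
      qed
      then have "(\<lambda>a\<in>carrier N. fst (\<gamma> (a, \<one>\<^bsub>H\<^esub>))) \<in> C"
        by (rule restrict_fixing_cosets_centralizer[OF comm \<gamma> inv[OF \<gamma>]])
      moreover have "\<gamma> (w, \<one>\<^bsub>H\<^esub>) = (x, \<one>\<^bsub>H\<^esub>)"
        using \<gamma>\<beta>[OF subsetD[OF F(2) y(1)]] y(3) \<beta>(3) by simp
      then have "x = (\<lambda>a\<in>carrier N. fst (\<gamma> (a, \<one>\<^bsub>H\<^esub>))) w" using wN by simp
      ultimately show ?thesis using w by (intro bexI)
    qed
    ultimately show "finite (orbits ((AutoGroup N)\<lparr>carrier := C\<rparr>) (carrier N) (\<lambda>c. c))"
      unfolding onN.finite_orbits_iff by (intro exI[of _ R]) simp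
  qed
  then show ?thesis by (simp add: omega_def Let_def)
qed

end

theorem theorem1p1:
  fixes A :: "('a, 'm) monoid_scheme"
    and B :: "('a \<Rightarrow> 'a) set"
    and G :: "('a \<times> ('a \<Rightarrow> 'a)) monoid"
  assumes "comm_group A"
    and "subgroup B (AutoGroup A)"
    and "finite B"
    and "G = semidirect A ((AutoGroup A)\<lparr>carrier := B\<rparr>) (\<lambda>b. b)"
    and "characteristic_subgroup (carrier A \<times> {\<one>\<^bsub>AutoGroup A\<^esub>}) G"
  shows "omega G < \<infinity> \<longleftrightarrow>
    finite (orbits ((AutoGroup A)\<lparr>carrier := centralizer (AutoGroup A) B\<rparr>)
      (carrier A) (\<lambda>c. c))"
proof -
  have A: "group A" using assms(1) by (rule comm_group.axioms(2))
  \<comment> \<open>With the inclusion as \<open>\<theta>\<close>, the image of the acting group is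
    \<open>B\<close> itself, so \<open>C\<close> becomes the centralizer of
    \<open>B\<close>.\<close>
  interpret semidirect_product A "(AutoGroup A)\<lparr>carrier := B\<rparr>" "\<lambda>b. b"
    using A subgroup.subgroup_is_group[OF assms(2) group.AutoGroup[OF A]]
      inclusion_hom_AutoGroup[OF A assms(2)]
    by (simp add: semidirect_product_def semidirect_product_axioms_def)
  show ?thesis
    using finite_omega_iff_finite_centralizer_orbits assms by simp
qed

end
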